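(* Let $\xi$ be a real random variable on a probability space $(\Omega,\mathscr{F},\mathbb{P})$ with $\mathbb{P}(\xi>0)>0$ and $\mathbb{P}(\xi<0)>0$, and let $\varphi$, $a$, $b$, $\psi$, $E$ be as defined in the context. The Esscher parameter $\kappa_0$ exists in the following cases: (i) $-\infty\le a<b\le+\infty$ and $E=(a,b)$. (ii) $-\infty\le a<b<+\infty$ and $E=(a,b]$ with $\psi(b)\ge0$. (iii) $-\infty<a<b\le+\infty$ and $E=[a,b)$ with $\psi(a)\le0$. (iv) $-\infty<a\le b<+\infty$ and $E=[a,b]$ with $\psi(a)\le0\le\psi(b)$. In all other cases, the Esscher parameter does not exist.
   Context: Define $\varphi(\kappa)=\mathbb{E}[\exp(\kappa\xi)]\in(0,+\infty]$ for $\kappa\in\mathbb{R}$, and $I=\{\kappa\in\mathbb{R}:\varphi(\kappa)<+\infty\}$, which is an interval containing $0$, with endpoints $a,b$, $-\infty\le a\le0\le b\le+\infty$. For $\kappa\in\mathbb{R}$ put $\psi(\kappa)=\mathbb{E}[\xi\exp(\kappa\xi)]$ whenever this integral exists in $[-\infty,+\infty]$, and let $E=\{\kappa\in\mathbb{R}:\ \psi(\kappa)\text{ exists and }-\infty<\psi(\kappa)<+\infty\}$; one has $(a,b)\subseteq E\subseteq I$. An Esscher parameter is a point $\kappa_0\in[a,b]\cap\mathbb{R}$ such that $\kappa_0\in E$ and $\psi(\kappa_0)=0$. (For $\xi=L_T$ with $L$ a Lévy process on $[0,T]$, existence of an Esscher parameter is existence of the Esscher martingale measure $d\mathbb{P}^{\kappa_0}=\frac{\exp(\kappa_0L_T)}{\mathbb{E}[\exp(\kappa_0L_T)]}d\mathbb{P}$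 for $L$.) *)

theory Defs
  imports "HOL-Probability.Probability"
begin

text \<open>
  The integral of a real function as an extended real number. It exists as soon as the positive
  or the negative part has a finite integral; the library's integral would return 0 when the
  value is infinite. \<open>ext_integral\<close> is meaningful only under \<open>ext_integral_exists\<close>.
\<close>

definition ext_integral_exists :: "'a measure \<Rightarrow> ('a \<Rightarrow> real) \<Rightarrow> bool" where
  "ext_integral_exists M f \<longleftrightarrow>
     f \<in> borel_measurable M \<and>
     ((\<integral>\<^sup>+ \<omega>. ennreal (f \<omega>) \<partial>M) < \<infinity> \<or> (\<integral>\<^sup>+ \<omega>. ennreal (- f \<omega>) \<partial>M) < \<infinity>)"

definition ext_integral :: "'a measure \<Rightarrow> ('a \<Rightarrow> real) \<Rightarrow> ereal" where
  "ext_integral M f =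
     enn2ereal (\<integral>\<^sup>+ \<omega>. ennreal (f \<omega>) \<partial>M) - enn2ereal (\<integral>\<^sup>+ \<omega>. ennreal (- f \<omega>) \<partial>M)"

lemma ext_integral_finite_iff:
  "ext_integral_exists M f \<and> - \<infinity> < ext_integral M f \<and> ext_integral M f < \<infinity> \<longleftrightarrow> integrable M f"
  unfolding ext_integral_exists_def ext_integral_def real_integrable_def
  by (cases "\<integral>\<^sup>+ \<omega>. ennreal (f \<omega>) \<partial>M"; cases "\<integral>\<^sup>+ \<omega>. ennreal (- f \<omega>) \<partial>M")
     (auto simp: enn2ereal_ennreal top_ennreal.rep_eq)

lemma ext_integral_eq_lebesgue_integral:
  assumes "integrable M f"
  shows "ext_integral M f = ereal (integral\<^sup>L M f)"
  using assms unfolding real_lebesgue_integral_def[OF assms] ext_integral_def real_integrable_def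
  by (cases "\<integral>\<^sup>+ \<omega>. ennreal (f \<omega>) \<partial>M"; cases "\<integral>\<^sup>+ \<omega>. ennreal (- f \<omega>) \<partial>M")
     (auto simp: enn2ereal_ennreal)

definition exp_moment :: "'a measure \<Rightarrow> ('a \<Rightarrow> real) \<Rightarrow> real \<Rightarrow> ennreal" where
  "exp_moment M \<xi> \<kappa> = (\<integral>\<^sup>+ \<omega>. ennreal (exp (\<kappa> * \<xi> \<omega>)) \<partial>M)"

definition exp_moment_dom :: "'a measure \<Rightarrow> ('a \<Rightarrow> real) \<Rightarrow> real set" where
  "exp_moment_dom M \<xi> = {\<kappa>. exp_moment M \<xi> \<kappa> < \<infinity>}"

definition left_end :: "'a measure \<Rightarrow> ('a \<Rightarrow> real) \<Rightarrow> ereal" where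
  "left_end M \<xi> = (INF \<kappa>\<in>exp_moment_dom M \<xi>. ereal \<kappa>)"

definition right_end :: "'a measure \<Rightarrow> ('a \<Rightarrow> real) \<Rightarrow> ereal" where
  "right_end M \<xi> = (SUP \<kappa>\<in>exp_moment_dom M \<xi>. ereal \<kappa>)"

definition psi_exists :: "'a measure \<Rightarrow> ('a \<Rightarrow> real) \<Rightarrow> real \<Rightarrow> bool" where
  "psi_exists M \<xi> \<kappa> \<longleftrightarrow> ext_integral_exists M (\<lambda>\<omega>. \<xi> \<omega> * exp (\<kappa> * \<xi> \<omega>))"

definition psi :: "'a measure \<Rightarrow> ('a \<Rightarrow> real) \<Rightarrow> real \<Rightarrow> ereal" where
  "psi M \<xi> \<kappa> = ext_integral M (\<lambda>\<omega>. \<xi> \<omega> * exp (\<kappa> * \<xi> \<omega>))"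

definition psi_dom :: "'a measure \<Rightarrow> ('a \<Rightarrow> real) \<Rightarrow> real set" where
  "psi_dom M \<xi> = {\<kappa>. psi_exists M \<xi> \<kappa> \<and> - \<infinity> < psi M \<xi> \<kappa> \<and> psi M \<xi> \<kappa> < \<infinity>}"

definition esscher_parameter :: "'a measure \<Rightarrow> ('a \<Rightarrow> real) \<Rightarrow> real \<Rightarrow> bool" where
  "esscher_parameter M \<xi> \<kappa> \<longleftrightarrow>
     left_end M \<xi> \<le> ereal \<kappa> \<and> ereal \<kappa> \<le> right_end M \<xi> \<and>
     \<kappa> \<in> psi_dom M \<xi> \<and> psi M \<xi> \<kappa> = 0"

end

theory Submission
  imports Defs
begin

text \<open>
  Write \<open>\<xi>\<close> for the random variable, \<open>E\<close> for the set of \<open>\<kappa>\<close> at which \<open>\<xi> exp (\<kappa> \<xi>)\<close> is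
  integrable, and \<open>\<psi> \<kappa>\<close> for the integral. Since \<open>x exp (\<kappa> x)\<close> is nondecreasing in \<open>\<kappa>\<close> for
  every real \<open>x\<close>, so is \<open>\<psi>\<close> on \<open>E\<close>. Since \<open>exp (\<kappa> x) \<le> exp (\<kappa>\<^sub>1 x) + exp (\<kappa>\<^sub>2 x)\<close> for
  \<open>\<kappa>\<^sub>1 \<le> \<kappa> \<le> \<kappa>\<^sub>2\<close>, the set \<open>E\<close> is convex and \<open>\<psi>\<close> is continuous on each segment contained
  in \<open>E\<close>, by dominated convergence (\<open>continuous_on_tilted_mean\<close>). By the intermediate value
  theorem, an Esscher parameter exists if and only if \<open>\<psi>\<close> takes both a value \<open>\<le> 0\<close> and a value
  \<open>\<ge> 0\<close>.

  Moreover \<open>(a, b) \<subseteq> E \<subseteq> [a, b]\<close>, because a linear factor is absorbed by an exponential one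
  (\<open>integrable_tilted_between\<close>, \<open>integrable_exp_of_tilted\<close>). So if \<open>a < b\<close> only the
  membership of the two endpoints in \<open>E\<close> is open. If \<open>a\<close> is a real number in \<open>E\<close>, then
  monotonicity makes \<open>\<psi> a \<le> 0\<close> necessary and sufficient for a value \<open>\<le> 0\<close>. If \<open>a\<close> is not in
  \<open>E\<close>, such a value always exists (\<open>tilted_mean_nonpos\<close>): as \<open>\<kappa>\<close> decreases to \<open>a\<close>, the part of
  the integral over \<open>\<xi> > 0\<close> stays bounded, while the part over \<open>\<xi> < 0\<close>, an event of
  positive probability, diverges. At the endpoint \<open>b\<close> the same holds for \<open>-\<xi>\<close>. If \<open>a = b\<close>, then
  \<open>E\<close> has no point besides \<open>a\<close>, and a parameter exists exactly when \<open>a \<in> E\<close> and \<open>\<psi> a = 0\<close>,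
  which is the degenerate form of the closed case.
\<close>

section \<open>Convexity, monotonicity and continuity\<close>

lemma exp_mult_between_le:
  fixes x \<kappa> \<kappa>\<^sub>1 \<kappa>\<^sub>2 :: real
  assumes "\<kappa>\<^sub>1 \<le> \<kappa>" "\<kappa> \<le> \<kappa>\<^sub>2"
  shows "exp (\<kappa> * x) \<le> exp (\<kappa>\<^sub>1 * x) + exp (\<kappa>\<^sub>2 * x)"
proof (cases "x \<ge> 0")
  case True
  then have "exp (\<kappa> * x) \<le> exp (\<kappa>\<^sub>2 * x)" using assms by (simp add: mult_right_mono)
  then show ?thesis using exp_ge_zero[of "\<kappa>\<^sub>1 * x"] by linarith
next
  case False
  then have "exp (\<kappa> * x) \<le> exp (\<kappa>\<^sub>1 * x)" using assms by (simp add: mult_right_mono_neg)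
  then show ?thesis using exp_ge_zero[of "\<kappa>\<^sub>2 * x"] by linarith
qed

lemma abs_tilted_between_le:
  fixes x \<kappa> \<kappa>\<^sub>1 \<kappa>\<^sub>2 :: real
  assumes "\<kappa>\<^sub>1 \<le> \<kappa>" "\<kappa> \<le> \<kappa>\<^sub>2"
  shows "\<bar>x * exp (\<kappa> * x)\<bar> \<le> \<bar>x * exp (\<kappa>\<^sub>1 * x)\<bar> + \<bar>x * exp (\<kappa>\<^sub>2 * x)\<bar>"
  using mult_left_mono[OF exp_mult_between_le[OF assms, of x], of "\<bar>x\<bar>"]
  by (simp add: abs_mult distrib_left)

lemma tilted_mono:
  fixes x \<kappa>\<^sub>1 \<kappa>\<^sub>2 :: real
  assumes "\<kappa>\<^sub>1 \<le> \<kappa>\<^sub>2"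
  shows "x * exp (\<kappa>\<^sub>1 * x) \<le> x * exp (\<kappa>\<^sub>2 * x)"
  using assms by (cases "x \<ge> 0") (auto intro: mult_left_mono mult_left_mono_neg mult_right_mono
      mult_right_mono_neg)

lemma integrable_tilted_convex:
  fixes \<xi> :: "'a \<Rightarrow> real"
  assumes [measurable]: "\<xi> \<in> borel_measurable M"
    and "integrable M (\<lambda>\<omega>. \<xi> \<omega> * exp (\<kappa>\<^sub>1 * \<xi> \<omega>))"
    and "integrable M (\<lambda>\<omega>. \<xi> \<omega> * exp (\<kappa>\<^sub>2 * \<xi> \<omega>))"
    and "\<kappa>\<^sub>1 \<le> \<kappa>" "\<kappa> \<le> \<kappa>\<^sub>2"
  shows "integrable M (\<lambda>\<omega>. \<xi> \<omega> * exp (\<kappa> * \<xi> \<omega>))"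
proof (rule Bochner_Integration.integrable_bound)
  show "integrable M (\<lambda>\<omega>. \<bar>\<xi> \<omega> * exp (\<kappa>\<^sub>1 * \<xi> \<omega>)\<bar> + \<bar>\<xi> \<omega> * exp (\<kappa>\<^sub>2 * \<xi> \<omega>)\<bar>)"
    using assms by (intro Bochner_Integration.integrable_add integrable_abs)
  show "AE \<omega> in M. norm (\<xi> \<omega> * exp (\<kappa> * \<xi> \<omega>))
      \<le> norm (\<bar>\<xi> \<omega> * exp (\<kappa>\<^sub>1 * \<xi> \<omega>)\<bar> + \<bar>\<xi> \<omega> * exp (\<kappa>\<^sub>2 * \<xi> \<omega>)\<bar>)"
    using abs_tilted_between_le[OF assms(4,5)] by (intro AE_I2) simp
qed measurable

lemma continuous_on_tilted_mean:
  fixes \<xi> :: "'a \<Rightarrow> real"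
  assumes [measurable]: "\<xi> \<in> borel_measurable M"
    and "integrable M (\<lambda>\<omega>. \<xi> \<omega> * exp (\<kappa>\<^sub>1 * \<xi> \<omega>))"
    and "integrable M (\<lambda>\<omega>. \<xi> \<omega> * exp (\<kappa>\<^sub>2 * \<xi> \<omega>))"
  shows "continuous_on {\<kappa>\<^sub>1..\<kappa>\<^sub>2} (\<lambda>\<kappa>. \<integral>\<omega>. \<xi> \<omega> * exp (\<kappa> * \<xi> \<omega>) \<partial>M)"
  unfolding continuous_on_sequentially
proof (intro allI ballI impI, elim conjE)
  fix s :: "nat \<Rightarrow> real" and \<kappa>
  assume s: "\<forall>n. s n \<in> {\<kappa>\<^sub>1..\<kappa>\<^sub>2}" "s \<longlonglongrightarrow> \<kappa>"
  show "((\<lambda>\<kappa>. \<integral>\<omega>. \<xi> \<omega> * exp (\<kappa> * \<xi> \<omega>) \<partial>M) \<circ> s) \<longlonglongrightarrow> (\<integral>\<omega>. \<xi> \<omega> * exp (\<kappa> * \<xi> \<omega>) \<partial>M)"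
    unfolding comp_def
  proof (rule integral_dominated_convergence
      [where w = "\<lambda>\<omega>. \<bar>\<xi> \<omega> * exp (\<kappa>\<^sub>1 * \<xi> \<omega>)\<bar> + \<bar>\<xi> \<omega> * exp (\<kappa>\<^sub>2 * \<xi> \<omega>)\<bar>"])
    show "integrable M (\<lambda>\<omega>. \<bar>\<xi> \<omega> * exp (\<kappa>\<^sub>1 * \<xi> \<omega>)\<bar> + \<bar>\<xi> \<omega> * exp (\<kappa>\<^sub>2 * \<xi> \<omega>)\<bar>)"
      using assms by (intro Bochner_Integration.integrable_add integrable_abs)
    show "AE \<omega> in M. (\<lambda>n. \<xi> \<omega> * exp (s n * \<xi> \<omega>)) \<longlonglongrightarrow> \<xi> \<omega> * exp (\<kappa> * \<xi> \<omega>)"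
      using s(2) by (intro AE_I2 tendsto_intros)
    show "AE \<omega> in M. norm (\<xi> \<omega> * exp (s n * \<xi> \<omega>))
        \<le> \<bar>\<xi> \<omega> * exp (\<kappa>\<^sub>1 * \<xi> \<omega>)\<bar> + \<bar>\<xi> \<omega> * exp (\<kappa>\<^sub>2 * \<xi> \<omega>)\<bar>" for n
      using abs_tilted_between_le s(1) by (intro AE_I2) auto
  qed measurable
qed

text \<open>
  For \<open>\<kappa>\<^sub>1 \<le> \<kappa>\<^sub>2\<close> this is the intermediate value theorem. In the opposite order, monotonicity
  forces the mean to vanish at \<open>\<kappa>\<^sub>1\<close> already.
\<close>

lemma tilted_mean_zero:
  fixes \<xi> :: "'a \<Rightarrow> real"
  assumes "\<xi> \<in> borel_measurable M"
    and int1: "integrable M (\<lambda>\<omega>. \<xi> \<omega> * exp (\<kappa>\<^sub>1 * \<xi> \<omega>))"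
    and int2: "integrable M (\<lambda>\<omega>. \<xi> \<omega> * exp (\<kappa>\<^sub>2 * \<xi> \<omega>))"
    and le1: "(\<integral>\<omega>. \<xi> \<omega> * exp (\<kappa>\<^sub>1 * \<xi> \<omega>) \<partial>M) \<le> 0"
    and ge2: "0 \<le> (\<integral>\<omega>. \<xi> \<omega> * exp (\<kappa>\<^sub>2 * \<xi> \<omega>) \<partial>M)"
  obtains \<kappa> where "integrable M (\<lambda>\<omega>. \<xi> \<omega> * exp (\<kappa> * \<xi> \<omega>))"
    and "(\<integral>\<omega>. \<xi> \<omega> * exp (\<kappa> * \<xi> \<omega>) \<partial>M) = 0"
proof (cases "\<kappa>\<^sub>1 \<le> \<kappa>\<^sub>2")
  case True
  obtain \<kappa> where "\<kappa>\<^sub>1 \<le> \<kappa>" "\<kappa> \<le> \<kappa>\<^sub>2" "(\<integral>\<omega>. \<xi> \<omega> * exp (\<kappa> * \<xi> \<omega>) \<partial>M) = 0"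
    using IVT'[OF le1 ge2 True continuous_on_tilted_mean[OF assms(1-3)]] by blast
  with integrable_tilted_convex[OF assms(1-3)] that show ?thesis by blast
next
  case False
  note ge2
  also have "(\<integral>\<omega>. \<xi> \<omega> * exp (\<kappa>\<^sub>2 * \<xi> \<omega>) \<partial>M) \<le> (\<integral>\<omega>. \<xi> \<omega> * exp (\<kappa>\<^sub>1 * \<xi> \<omega>) \<partial>M)"
    using False by (intro integral_mono int1 int2 tilted_mono) simp
  finally show ?thesis by (intro that[OF int1] order.antisym le1)
qed

section \<open>The two domains of integrability\<close>

text \<open>
  For \<open>\<bar>x\<bar> \<le> 1\<close> the value \<open>exp (\<kappa> x)\<close> is at most the constant \<open>exp \<bar>\<kappa>\<bar>\<close>, which is integrable
  because the measure is finite; for \<open>\<bar>x\<bar> > 1\<close> it is at most \<open>\<bar>x\<bar> exp (\<kappa> x)\<close>.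
\<close>

lemma integrable_exp_of_tilted:
  fixes \<xi> :: "'a \<Rightarrow> real"
  assumes "finite_measure M" and [measurable]: "\<xi> \<in> borel_measurable M"
    and "integrable M (\<lambda>\<omega>. \<xi> \<omega> * exp (\<kappa> * \<xi> \<omega>))"
  shows "integrable M (\<lambda>\<omega>. exp (\<kappa> * \<xi> \<omega>))"
proof (rule Bochner_Integration.integrable_bound)
  interpret finite_measure M by fact
  show "integrable M (\<lambda>\<omega>. exp \<bar>\<kappa>\<bar> + \<bar>\<xi> \<omega> * exp (\<kappa> * \<xi> \<omega>)\<bar>)"
    using assms by (intro Bochner_Integration.integrable_add integrable_abs) auto
  have "exp (\<kappa> * x) \<le> exp \<bar>\<kappa>\<bar> + \<bar>x * exp (\<kappa> * x)\<bar>" for x :: real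
  proof (cases "\<bar>x\<bar> \<le> 1")
    case True
    have "\<kappa> * x \<le> \<bar>\<kappa>\<bar> * \<bar>x\<bar>" by (simp flip: abs_mult)
    also have "\<dots> \<le> \<bar>\<kappa>\<bar>" using True by (simp add: mult_left_le)
    finally show ?thesis by (simp add: add_increasing2)
  next
    case False
    then have "1 * exp (\<kappa> * x) \<le> \<bar>x\<bar> * exp (\<kappa> * x)" by (intro mult_right_mono) auto
    then show ?thesis by (simp add: abs_mult add_increasing)
  qed
  then show "AE \<omega> in M. norm (exp (\<kappa> * \<xi> \<omega>)) \<le> norm (exp \<bar>\<kappa>\<bar> + \<bar>\<xi> \<omega> * exp (\<kappa> * \<xi> \<omega>)\<bar>)"
    by (intro AE_I2) (simp add: order.trans[OF _ abs_ge_self])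
qed measurable

text \<open>
  If \<open>d\<close> is at most the distance from \<open>\<kappa>\<close> to \<open>\<kappa>\<^sub>1\<close> and \<open>\<kappa>\<^sub>2\<close>, then
  \<open>d \<bar>x\<bar> exp (\<kappa> x) \<le> exp (\<kappa> x + d \<bar>x\<bar>)\<close>, and the exponent is \<open>(\<kappa> + d) x\<close> or \<open>(\<kappa> - d) x\<close>.
\<close>

lemma integrable_tilted_between:
  fixes \<xi> :: "'a \<Rightarrow> real"
  assumes [measurable]: "\<xi> \<in> borel_measurable M"
    and int1: "integrable M (\<lambda>\<omega>. exp (\<kappa>\<^sub>1 * \<xi> \<omega>))"
    and int2: "integrable M (\<lambda>\<omega>. exp (\<kappa>\<^sub>2 * \<xi> \<omega>))"
    and less: "\<kappa>\<^sub>1 < \<kappa>" "\<kappa> < \<kappa>\<^sub>2"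
  shows "integrable M (\<lambda>\<omega>. \<xi> \<omega> * exp (\<kappa> * \<xi> \<omega>))"
proof (rule Bochner_Integration.integrable_bound)
  define d where "d = min (\<kappa> - \<kappa>\<^sub>1) (\<kappa>\<^sub>2 - \<kappa>)"
  have d: "d > 0" "\<kappa>\<^sub>1 \<le> \<kappa> - d" "\<kappa> + d \<le> \<kappa>\<^sub>2" using less by (auto simp: d_def)
  show "integrable M (\<lambda>\<omega>. (exp (\<kappa>\<^sub>1 * \<xi> \<omega>) + exp (\<kappa>\<^sub>2 * \<xi> \<omega>)) / d)"
    using int1 int2 by simp
  have "\<bar>x * exp (\<kappa> * x)\<bar> \<le> (exp (\<kappa>\<^sub>1 * x) + exp (\<kappa>\<^sub>2 * x)) / d" for x :: real
  proof -
    define \<kappa>' where "\<kappa>' = (if x \<ge> 0 then \<kappa> + d else \<kappa> - d)"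
    have "d * \<bar>x\<bar> \<le> exp (d * \<bar>x\<bar>)" using exp_ge_add_one_self[of "d * \<bar>x\<bar>"] by linarith
    then have "d * \<bar>x\<bar> * exp (\<kappa> * x) \<le> exp (d * \<bar>x\<bar>) * exp (\<kappa> * x)"
      by (intro mult_right_mono) auto
    also have "\<dots> = exp (\<kappa>' * x)" by (auto simp: \<kappa>'_def algebra_simps simp flip: exp_add)
    also have "\<dots> \<le> exp (\<kappa>\<^sub>1 * x) + exp (\<kappa>\<^sub>2 * x)"
      using d less by (intro exp_mult_between_le) (auto simp: \<kappa>'_def)
    finally show ?thesis using d by (simp add: abs_mult field_simps)
  qed
  then show "AE \<omega> in M. norm (\<xi> \<omega> * exp (\<kappa> * \<xi> \<omega>))
      \<le> norm ((exp (\<kappa>\<^sub>1 * \<xi> \<omega>) + exp (\<kappa>\<^sub>2 * \<xi> \<omega>)) / d)"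
    using d(1) by (intro AE_I2) simp
qed measurable

lemma exp_moment_dom_iff:
  assumes "\<xi> \<in> borel_measurable M"
  shows "\<kappa> \<in> exp_moment_dom M \<xi> \<longleftrightarrow> integrable M (\<lambda>\<omega>. exp (\<kappa> * \<xi> \<omega>))"
  using assms unfolding exp_moment_dom_def exp_moment_def integrable_iff_bounded by simp

lemma psi_dom_iff: "\<kappa> \<in> psi_dom M \<xi> \<longleftrightarrow> integrable M (\<lambda>\<omega>. \<xi> \<omega> * exp (\<kappa> * \<xi> \<omega>))"
  unfolding psi_dom_def psi_exists_def psi_def by (simp only: mem_Collect_eq ext_integral_finite_iff)

lemma psi_eq_integral:
  assumes "\<kappa> \<in> psi_dom M \<xi>"
  shows "psi M \<xi> \<kappa> = ereal (\<integral>\<omega>. \<xi> \<omega> * exp (\<kappa> * \<xi> \<omega>) \<partial>M)"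
  using assms unfolding psi_dom_iff psi_def by (rule ext_integral_eq_lebesgue_integral)

lemma psi_mono:
  assumes "\<kappa>\<^sub>1 \<in> psi_dom M \<xi>" "\<kappa>\<^sub>2 \<in> psi_dom M \<xi>" "\<kappa>\<^sub>1 \<le> \<kappa>\<^sub>2"
  shows "psi M \<xi> \<kappa>\<^sub>1 \<le> psi M \<xi> \<kappa>\<^sub>2"
  using assms by (auto simp: psi_eq_integral psi_dom_iff intro!: integral_mono tilted_mono)

lemma psi_dom_bounds:
  assumes "finite_measure M" "\<xi> \<in> borel_measurable M" "\<kappa> \<in> psi_dom M \<xi>"
  shows "left_end M \<xi> \<le> ereal \<kappa>" "ereal \<kappa> \<le> right_end M \<xi>"
proof -
  have "\<kappa> \<in> exp_moment_dom M \<xi>"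
    using assms integrable_exp_of_tilted by (simp add: exp_moment_dom_iff psi_dom_iff)
  then show "left_end M \<xi> \<le> ereal \<kappa>" "ereal \<kappa> \<le> right_end M \<xi>"
    unfolding left_end_def right_end_def by (auto intro: INF_lower SUP_upper)
qed

lemma psi_dom_if_between:
  assumes "\<xi> \<in> borel_measurable M" "left_end M \<xi> < ereal \<kappa>" "ereal \<kappa> < right_end M \<xi>"
  shows "\<kappa> \<in> psi_dom M \<xi>"
proof -
  obtain \<kappa>\<^sub>1 where "\<kappa>\<^sub>1 \<in> exp_moment_dom M \<xi>" "\<kappa>\<^sub>1 < \<kappa>"
    using assms(2) unfolding left_end_def by (auto simp: INF_less_iff)
  moreover obtain \<kappa>\<^sub>2 where "\<kappa>\<^sub>2 \<in> exp_moment_dom M \<xi>" "\<kappa> < \<kappa>\<^sub>2"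
    using assms(3) unfolding right_end_def by (auto simp: less_SUP_iff)
  ultimately show ?thesis
    using integrable_tilted_between assms(1) by (auto simp: exp_moment_dom_iff psi_dom_iff)
qed

lemma esscher_parameter_iff:
  assumes "finite_measure M" "\<xi> \<in> borel_measurable M"
  shows "esscher_parameter M \<xi> \<kappa> \<longleftrightarrow> \<kappa> \<in> psi_dom M \<xi> \<and> psi M \<xi> \<kappa> = 0"
  using psi_dom_bounds[OF assms] by (auto simp: esscher_parameter_def)

lemma ex_esscher_parameter_if_sign_change:
  assumes "finite_measure M" "\<xi> \<in> borel_measurable M"
    and "\<kappa>\<^sub>1 \<in> psi_dom M \<xi>" "psi M \<xi> \<kappa>\<^sub>1 \<le> 0"
    and "\<kappa>\<^sub>2 \<in> psi_dom M \<xi>" "0 \<le> psi M \<xi> \<kappa>\<^sub>2"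
  shows "\<exists>\<kappa>. esscher_parameter M \<xi> \<kappa>"
proof -
  obtain \<kappa> where "integrable M (\<lambda>\<omega>. \<xi> \<omega> * exp (\<kappa> * \<xi> \<omega>))"
    and "(\<integral>\<omega>. \<xi> \<omega> * exp (\<kappa> * \<xi> \<omega>) \<partial>M) = 0"
    using tilted_mean_zero[of \<xi> M \<kappa>\<^sub>1 \<kappa>\<^sub>2] assms(2-) by (auto simp: psi_eq_integral psi_dom_iff)
  then show ?thesis
    using assms(1,2) by (auto simp: esscher_parameter_iff psi_eq_integral psi_dom_iff zero_ereal_def)
qed

section \<open>Divergence at an excluded endpoint\<close>

text \<open>
  Otherwise the negative part of the integral would, for all \<open>\<kappa> \<in> (a, \<kappa>\<^sub>0]\<close>, be at most the
  positive part, hence at most the positive part \<open>C\<close> at \<open>\<kappa>\<^sub>0\<close>. For real \<open>a\<close>, Fatou's lemma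
  carries the bound over to \<open>a\<close>, where integrability is excluded. For \<open>a = -\<infinity>\<close>, the bound
  \<open>y exp (n y) \<ge> n y\<^sup>2\<close> for \<open>y \<ge> 0\<close> makes \<open>n\<close> times the second moment of the negative part of
  \<open>\<xi>\<close> at most \<open>C\<close> for all large \<open>n\<close>, so that \<open>\<xi> \<ge> 0\<close> almost everywhere.
\<close>

lemma tilted_mean_nonpos:
  fixes \<xi> :: "'a \<Rightarrow> real" and a :: ereal
  assumes meas[measurable]: "\<xi> \<in> borel_measurable M"
    and neg: "\<not> (AE \<omega> in M. 0 \<le> \<xi> \<omega>)"
    and a: "a < ereal \<kappa>\<^sub>0"
    and int: "\<And>\<kappa>. a < ereal \<kappa> \<Longrightarrow> \<kappa> \<le> \<kappa>\<^sub>0 \<Longrightarrow> integrable M (\<lambda>\<omega>. \<xi> \<omega> * exp (\<kappa> * \<xi> \<omega>))"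
    and nint: "\<And>\<kappa>. a = ereal \<kappa> \<Longrightarrow> \<not> integrable M (\<lambda>\<omega>. \<xi> \<omega> * exp (\<kappa> * \<xi> \<omega>))"
  obtains \<kappa> where "a < ereal \<kappa>" "\<kappa> \<le> \<kappa>\<^sub>0" "(\<integral>\<omega>. \<xi> \<omega> * exp (\<kappa> * \<xi> \<omega>) \<partial>M) \<le> 0"
proof (rule ccontr)
  assume "\<not> thesis"
  then have pos: "0 < (\<integral>\<omega>. \<xi> \<omega> * exp (\<kappa> * \<xi> \<omega>) \<partial>M)" if "a < ereal \<kappa>" "\<kappa> \<le> \<kappa>\<^sub>0" for \<kappa>
    using that \<open>\<And>\<kappa>. a < ereal \<kappa> \<Longrightarrow> \<kappa> \<le> \<kappa>\<^sub>0 \<Longrightarrow> (\<integral>\<omega>. \<xi> \<omega> * exp (\<kappa> * \<xi> \<omega>) \<partial>M) \<le> 0 \<Longrightarrow> thesis\<close>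
    by (meson not_le)
  define C where "C = (\<integral>\<^sup>+\<omega>. ennreal (\<xi> \<omega> * exp (\<kappa>\<^sub>0 * \<xi> \<omega>)) \<partial>M)"
  have C: "C < \<infinity>"
    using int[OF a] by (simp add: C_def real_integrable_def less_top)
  have pos_part: "(\<integral>\<^sup>+\<omega>. ennreal (\<xi> \<omega> * exp (\<kappa> * \<xi> \<omega>)) \<partial>M) \<le> C" if "\<kappa> \<le> \<kappa>\<^sub>0" for \<kappa>
    unfolding C_def by (intro nn_integral_mono ennreal_leI tilted_mono that)
  have neg_part: "(\<integral>\<^sup>+\<omega>. ennreal (- (\<xi> \<omega> * exp (\<kappa> * \<xi> \<omega>))) \<partial>M) \<le> C"
    if \<kappa>: "a < ereal \<kappa>" "\<kappa> \<le> \<kappa>\<^sub>0" for \<kappa>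
  proof -
    let ?P = "\<integral>\<^sup>+\<omega>. ennreal (\<xi> \<omega> * exp (\<kappa> * \<xi> \<omega>)) \<partial>M"
    let ?N = "\<integral>\<^sup>+\<omega>. ennreal (- (\<xi> \<omega> * exp (\<kappa> * \<xi> \<omega>))) \<partial>M"
    have fin: "?P \<noteq> \<infinity>" "?N \<noteq> \<infinity>" using int[OF \<kappa>] by (auto simp: real_integrable_def)
    have "enn2real ?N \<le> enn2real ?P"
      using pos[OF \<kappa>] real_lebesgue_integral_def[OF int[OF \<kappa>]] by simp
    then have "?N \<le> ?P" using fin by (cases ?N; cases ?P) auto
    also have "\<dots> \<le> C" by (rule pos_part) fact
    finally show ?thesis .
  qed
  show False
  proof (cases a)
    case (real r)
    define s where "s n = r + (\<kappa>\<^sub>0 - r) / real (Suc n)" for n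
    have r: "r < \<kappa>\<^sub>0" using a real by simp
    have s: "a < ereal (s n)" "s n \<le> \<kappa>\<^sub>0" for n
    proof -
      show "a < ereal (s n)" using r real by (simp add: s_def)
      have "(\<kappa>\<^sub>0 - r) / real (Suc n) \<le> (\<kappa>\<^sub>0 - r) / 1" using r by (intro divide_left_mono) auto
      then show "s n \<le> \<kappa>\<^sub>0" by (simp add: s_def)
    qed
    have "s \<longlonglongrightarrow> r + 0"
      unfolding s_def by (intro tendsto_add tendsto_const LIMSEQ_Suc lim_const_over_n)
    then have lim: "(\<lambda>n. ennreal (- (\<xi> \<omega> * exp (s n * \<xi> \<omega>)))) \<longlonglongrightarrow> ennreal (- (\<xi> \<omega> * exp (r * \<xi> \<omega>)))"
      for \<omega> by (intro tendsto_intros) simp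
    have "(\<integral>\<^sup>+\<omega>. ennreal (- (\<xi> \<omega> * exp (r * \<xi> \<omega>))) \<partial>M)
        = (\<integral>\<^sup>+\<omega>. liminf (\<lambda>n. ennreal (- (\<xi> \<omega> * exp (s n * \<xi> \<omega>)))) \<partial>M)"
      by (intro nn_integral_cong lim_imp_Liminf[symmetric] lim) simp
    also have "\<dots> \<le> liminf (\<lambda>n. \<integral>\<^sup>+\<omega>. ennreal (- (\<xi> \<omega> * exp (s n * \<xi> \<omega>))) \<partial>M)"
      by (rule nn_integral_liminf) measurable
    also have "\<dots> \<le> C"
      using neg_part[OF s] by (intro Liminf_le) auto
    finally have "(\<integral>\<^sup>+\<omega>. ennreal (- (\<xi> \<omega> * exp (r * \<xi> \<omega>))) \<partial>M) \<le> C" .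
    then have "integrable M (\<lambda>\<omega>. \<xi> \<omega> * exp (r * \<xi> \<omega>))"
      using C pos_part[of r] r by (auto simp: real_integrable_def less_top[symmetric] top_unique)
    then show False using nint[OF real] by simp
  next
    case PInf
    then show False using a by simp
  next
    case MInf
    define S where "S = (\<integral>\<^sup>+\<omega>. ennreal ((max 0 (- \<xi> \<omega>))\<^sup>2) \<partial>M)"
    have bound: "of_nat n * S \<le> C" if n: "- real n \<le> \<kappa>\<^sub>0" for n :: nat
    proof -
      have "real n * (max 0 (- x))\<^sup>2 \<le> max 0 (- (x * exp (- real n * x)))" for x :: real
      proof (cases "x < 0")
        case True
        have "real n * (- x) \<le> exp (real n * (- x))"
          using exp_ge_add_one_self[of "real n * (- x)"] by linarith
        then have "(- x) * (real n * (- x)) \<le> (- x) * exp (real n * (- x))"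
          using True by (intro mult_left_mono) auto
        then show ?thesis using True by (simp add: power2_eq_square algebra_simps)
      qed simp
      from ennreal_leI[OF this]
      have le: "of_nat n * ennreal ((max 0 (- x))\<^sup>2) \<le> ennreal (- (x * exp (- real n * x)))" for x
        by (simp only: ennreal_max_0 ennreal_mult' of_nat_0_le_iff ennreal_of_nat_eq_real_of_nat)
      have "of_nat n * S = (\<integral>\<^sup>+\<omega>. of_nat n * ennreal ((max 0 (- \<xi> \<omega>))\<^sup>2) \<partial>M)"
        unfolding S_def by (intro nn_integral_cmult[symmetric]) measurable
      also have "\<dots> \<le> (\<integral>\<^sup>+\<omega>. ennreal (- (\<xi> \<omega> * exp (- real n * \<xi> \<omega>))) \<partial>M)"
        by (intro nn_integral_mono le)
      also have "\<dots> \<le> C" using MInf n by (intro neg_part) auto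
      finally show ?thesis .
    qed
    have "S = 0"
    proof (rule ccontr)
      assume "S \<noteq> 0"
      obtain k :: nat where k: "- \<kappa>\<^sub>0 \<le> real k" using real_arch_simple by blast
      have "of_nat n * S \<le> C" for n
      proof -
        have "of_nat n * S \<le> of_nat (max n k) * S" by (intro mult_right_mono) auto
        also have "\<dots> \<le> C" using k by (intro bound) auto
        finally show ?thesis .
      qed
      then have "(SUP n. of_nat n * S) \<le> C" by (intro SUP_least)
      moreover have "(SUP n. of_nat n * S) = (\<infinity> :: ennreal)"
        using \<open>S \<noteq> 0\<close> by (simp flip: SUP_mult_right_ennreal
            add: ennreal_SUP_of_nat_eq_top ennreal_top_mult)
      ultimately show False using C by simp
    qed
    then have "AE \<omega> in M. ennreal ((max 0 (- \<xi> \<omega>))\<^sup>2) = 0"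
      unfolding S_def by (subst (asm) nn_integral_0_iff_AE) auto
    then have "AE \<omega> in M. 0 \<le> \<xi> \<omega>"
      by eventually_elim (auto simp: max_def ennreal_eq_0_iff split: if_splits)
    then show False using neg by simp
  qed
qed

lemma ex_psi_nonpos:
  assumes "\<xi> \<in> borel_measurable M" "\<not> (AE \<omega> in M. 0 \<le> \<xi> \<omega>)"
    and "left_end M \<xi> < right_end M \<xi>"
    and "\<And>\<kappa>. \<kappa> \<in> psi_dom M \<xi> \<Longrightarrow> left_end M \<xi> \<noteq> ereal \<kappa>"
  shows "\<exists>\<kappa>. \<kappa> \<in> psi_dom M \<xi> \<and> psi M \<xi> \<kappa> \<le> 0"
proof -
  obtain \<kappa>\<^sub>0 where \<kappa>\<^sub>0: "left_end M \<xi> < ereal \<kappa>\<^sub>0" "ereal \<kappa>\<^sub>0 < right_end M \<xi>"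
    using ereal_dense2[OF assms(3)] by blast
  have dom: "\<kappa> \<in> psi_dom M \<xi>" if "left_end M \<xi> < ereal \<kappa>" "\<kappa> \<le> \<kappa>\<^sub>0" for \<kappa>
    using \<kappa>\<^sub>0(2) that by (intro psi_dom_if_between assms) (auto elim: le_less_trans[rotated])
  obtain \<kappa> where "left_end M \<xi> < ereal \<kappa>" "\<kappa> \<le> \<kappa>\<^sub>0" "(\<integral>\<omega>. \<xi> \<omega> * exp (\<kappa> * \<xi> \<omega>) \<partial>M) \<le> 0"
    using tilted_mean_nonpos[OF assms(1,2) \<kappa>\<^sub>0(1)] dom assms(4) by (auto simp: psi_dom_iff)
  with dom[of \<kappa>] show ?thesis by (intro exI[of _ \<kappa>]) (simp add: psi_eq_integral)
qed

text \<open>The substitution \<open>\<xi> \<mapsto> -\<xi>\<close>, \<open>\<kappa> \<mapsto> -\<kappa>\<close> exchanges the endpoints and reverses the sign of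
  the mean.\<close>

lemma ex_psi_nonneg:
  assumes meas: "\<xi> \<in> borel_measurable M" and "\<not> (AE \<omega> in M. \<xi> \<omega> \<le> 0)"
    and "left_end M \<xi> < right_end M \<xi>"
    and "\<And>\<kappa>. \<kappa> \<in> psi_dom M \<xi> \<Longrightarrow> right_end M \<xi> \<noteq> ereal \<kappa>"
  shows "\<exists>\<kappa>. \<kappa> \<in> psi_dom M \<xi> \<and> 0 \<le> psi M \<xi> \<kappa>"
proof -
  have dom: "exp_moment_dom M (\<lambda>\<omega>. - \<xi> \<omega>) = uminus ` exp_moment_dom M \<xi>"
    by (force simp: exp_moment_dom_def exp_moment_def image_iff
        intro: minus_minus[symmetric])
  have ends: "left_end M (\<lambda>\<omega>. - \<xi> \<omega>) = - right_end M \<xi>" "right_end M (\<lambda>\<omega>. - \<xi> \<omega>) = - left_end M \<xi>"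
    unfolding left_end_def right_end_def dom
    by (simp_all add: image_image ereal_INF_uminus_eq ereal_SUP_uminus_eq flip: uminus_ereal.simps(1))
  have psi_dom: "\<kappa> \<in> psi_dom M (\<lambda>\<omega>. - \<xi> \<omega>) \<longleftrightarrow> - \<kappa> \<in> psi_dom M \<xi>" for \<kappa>
    by (simp add: psi_dom_iff)
  have "\<exists>\<kappa>. \<kappa> \<in> psi_dom M (\<lambda>\<omega>. - \<xi> \<omega>) \<and> psi M (\<lambda>\<omega>. - \<xi> \<omega>) \<kappa> \<le> 0"
  proof (rule ex_psi_nonpos)
    show "left_end M (\<lambda>\<omega>. - \<xi> \<omega>) \<noteq> ereal \<kappa>" if "\<kappa> \<in> psi_dom M (\<lambda>\<omega>. - \<xi> \<omega>)" for \<kappa>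
      using that assms(4)[of "- \<kappa>"] by (auto simp: ends psi_dom ereal_uminus_eq_reorder)
  qed (use assms in \<open>simp_all add: ends\<close>)
  then obtain \<kappa> where \<kappa>: "- \<kappa> \<in> psi_dom M \<xi>" "psi M (\<lambda>\<omega>. - \<xi> \<omega>) \<kappa> \<le> 0"
    by (auto simp: psi_dom)
  then have "0 \<le> psi M \<xi> (- \<kappa>)"
    using psi_eq_integral[of \<kappa> M "\<lambda>\<omega>. - \<xi> \<omega>"] psi_eq_integral[OF \<kappa>(1)] by (simp add: psi_dom)
  with \<kappa> show ?thesis by blast
qed

section \<open>Existence of the Esscher parameter\<close>

text \<open>
  The conditions at the endpoints are vacuous when an endpoint is infinite or excluded, so that this
  one criterion treats the open, half-open and closed domains together.
\<close>

lemma ex_esscher_parameter_iff: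
  assumes "finite_measure M" and meas: "\<xi> \<in> borel_measurable M"
    and "\<not> (AE \<omega> in M. 0 \<le> \<xi> \<omega>)" "\<not> (AE \<omega> in M. \<xi> \<omega> \<le> 0)"
    and less: "left_end M \<xi> < right_end M \<xi>"
  shows "(\<exists>\<kappa>. esscher_parameter M \<xi> \<kappa>) \<longleftrightarrow>
      (\<forall>\<kappa>\<in>psi_dom M \<xi>. left_end M \<xi> = ereal \<kappa> \<longrightarrow> psi M \<xi> \<kappa> \<le> 0) \<and>
      (\<forall>\<kappa>\<in>psi_dom M \<xi>. right_end M \<xi> = ereal \<kappa> \<longrightarrow> 0 \<le> psi M \<xi> \<kappa>)" (is "?L \<longleftrightarrow> ?A \<and> ?B")
proof
  assume ?L
  then obtain \<kappa>\<^sub>0 where "\<kappa>\<^sub>0 \<in> psi_dom M \<xi>" "psi M \<xi> \<kappa>\<^sub>0 = 0"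
    using assms(1,2) by (auto simp: esscher_parameter_iff)
  then show "?A \<and> ?B"
    using psi_mono psi_dom_bounds[OF assms(1,2)] by (metis ereal_less_eq(3))
next
  assume R: "?A \<and> ?B"
  have "\<exists>\<kappa>. \<kappa> \<in> psi_dom M \<xi> \<and> psi M \<xi> \<kappa> \<le> 0"
    using R ex_psi_nonpos[OF meas assms(3) less] by blast
  moreover have "\<exists>\<kappa>. \<kappa> \<in> psi_dom M \<xi> \<and> 0 \<le> psi M \<xi> \<kappa>"
    using R ex_psi_nonneg[OF meas assms(4) less] by blast
  ultimately show ?L
    using ex_esscher_parameter_if_sign_change assms(1,2) by blast
qed

theorem propositionA4:
  fixes M :: "'a measure" and \<xi> :: "'a \<Rightarrow> real" and a b :: ereal and E :: "real set"
  assumes "prob_space M"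
    and "\<xi> \<in> borel_measurable M"
    and "measure M {\<omega> \<in> space M. \<xi> \<omega> > 0} > 0"
    and "measure M {\<omega> \<in> space M. \<xi> \<omega> < 0} > 0"
    and "a = left_end M \<xi>" and "b = right_end M \<xi>" and "E = psi_dom M \<xi>"
  shows "(\<exists>\<kappa>\<^sub>0. esscher_parameter M \<xi> \<kappa>\<^sub>0) \<longleftrightarrow>
      (- \<infinity> \<le> a \<and> a < b \<and> b \<le> \<infinity> \<and> E = ereal -` {a<..<b})
    \<or> (- \<infinity> \<le> a \<and> a < b \<and> b < \<infinity> \<and> E = ereal -` {a<..b}
         \<and> psi M \<xi> (real_of_ereal b) \<ge> 0)
    \<or> (- \<infinity> < a \<and> a < b \<and> b \<le> \<infinity> \<and> E = ereal -` {a..<b}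
         \<and> psi M \<xi> (real_of_ereal a) \<le> 0)
    \<or> (- \<infinity> < a \<and> a \<le> b \<and> b < \<infinity> \<and> E = ereal -` {a..b}
         \<and> psi M \<xi> (real_of_ereal a) \<le> 0 \<and> 0 \<le> psi M \<xi> (real_of_ereal b))"
    (is "?L \<longleftrightarrow> ?R")
proof -
  interpret prob_space M by fact
  note fin = finite_measure_axioms and meas[measurable] = assms(2)
  have neg: "\<not> (AE \<omega> in M. 0 \<le> \<xi> \<omega>)"
  proof
    assume "AE \<omega> in M. 0 \<le> \<xi> \<omega>"
    then have "prob {\<omega> \<in> space M. \<xi> \<omega> < 0} = 0"
      by (subst prob_eq_0) (auto simp: not_less)
    with assms(4) show False by simp
  qed
  have pos: "\<not> (AE \<omega> in M. \<xi> \<omega> \<le> 0)"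
  proof
    assume "AE \<omega> in M. \<xi> \<omega> \<le> 0"
    then have "prob {\<omega> \<in> space M. \<xi> \<omega> > 0} = 0"
      by (subst prob_eq_0) (auto simp: not_less)
    with assms(3) show False by simp
  qed
  have upper: "a \<le> ereal \<kappa>" "ereal \<kappa> \<le> b" if "\<kappa> \<in> E" for \<kappa>
    using psi_dom_bounds[OF fin meas] that assms(5-7) by auto
  have lower: "\<kappa> \<in> E" if "a < ereal \<kappa>" "ereal \<kappa> < b" for \<kappa>
    using psi_dom_if_between[OF meas] that assms(5-7) by auto
  show ?thesis
  proof (cases "a < b")
    case True
    note iff = ex_esscher_parameter_iff[OF fin meas neg pos, folded assms(5-7), OF True]
    show ?thesis
      unfolding iff
    proof (intro iffI)
      assume R: "(\<forall>\<kappa>\<in>E. a = ereal \<kappa> \<longrightarrow> psi M \<xi> \<kappa> \<le> 0) \<and> (\<forall>\<kappa>\<in>E. b = ereal \<kappa> \<longrightarrow> 0 \<le> psi M \<xi> \<kappa>)"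
      consider "\<forall>\<kappa>\<in>E. a \<noteq> ereal \<kappa>" "\<forall>\<kappa>\<in>E. b \<noteq> ereal \<kappa>"
        | t where "\<forall>\<kappa>\<in>E. a \<noteq> ereal \<kappa>" "t \<in> E" "b = ereal t"
        | r where "r \<in> E" "a = ereal r" "\<forall>\<kappa>\<in>E. b \<noteq> ereal \<kappa>"
        | r t where "r \<in> E" "a = ereal r" "t \<in> E" "b = ereal t"
        by blast
      then show ?R
      proof cases
        case 1
        then have "\<kappa> \<in> E \<longleftrightarrow> a < ereal \<kappa> \<and> ereal \<kappa> < b" for \<kappa>
          using upper lower by (metis ereal.inject order.order_iff_strict)
        then have "E = ereal -` {a<..<b}" by (simp add: set_eq_iff)
        then show ?thesis using True by simp
      next
        case 2
        then have "\<kappa> \<in> E \<longleftrightarrow> a < ereal \<kappa> \<and> ereal \<kappa> \<le> b" for \<kappa>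
          using upper lower by (metis ereal.inject order.order_iff_strict)
        then have "E = ereal -` {a<..b}" by (simp add: set_eq_iff)
        then show ?thesis using True R 2 by simp
      next
        case 3
        then have "\<kappa> \<in> E \<longleftrightarrow> a \<le> ereal \<kappa> \<and> ereal \<kappa> < b" for \<kappa>
          using upper lower by (metis ereal.inject order.order_iff_strict)
        then have "E = ereal -` {a..<b}" by (simp add: set_eq_iff)
        then show ?thesis using True R 3 by simp
      next
        case 4
        then have "\<kappa> \<in> E \<longleftrightarrow> a \<le> ereal \<kappa> \<and> ereal \<kappa> \<le> b" for \<kappa>
          using upper lower by (metis ereal.inject order.order_iff_strict)
        then have "E = ereal -` {a..b}" by (simp add: set_eq_iff)
        then show ?thesis using True R 4 by simp
      qed
    next
      assume R: ?R
      have "psi M \<xi> \<kappa> \<le> 0" if "\<kappa> \<in> E" "a = ereal \<kappa>" for \<kappa>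
      proof -
        have "\<kappa> \<notin> ereal -` {a<..<b}" "\<kappa> \<notin> ereal -` {a<..b}" using that(2) by simp_all
        with R that(1) have "psi M \<xi> (real_of_ereal a) \<le> 0" by metis
        then show ?thesis by (simp add: that(2))
      qed
      moreover have "0 \<le> psi M \<xi> \<kappa>" if "\<kappa> \<in> E" "b = ereal \<kappa>" for \<kappa>
      proof -
        have "\<kappa> \<notin> ereal -` {a<..<b}" "\<kappa> \<notin> ereal -` {a..<b}" using that(2) by simp_all
        with R that(1) have "0 \<le> psi M \<xi> (real_of_ereal b)" by metis
        then show ?thesis by (simp add: that(2))
      qed
      ultimately show "(\<forall>\<kappa>\<in>E. a = ereal \<kappa> \<longrightarrow> psi M \<xi> \<kappa> \<le> 0) \<and> (\<forall>\<kappa>\<in>E. b = ereal \<kappa> \<longrightarrow> 0 \<le> psi M \<xi> \<kappa>)"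
        by blast
    qed
  next
    case False
    have sing: "a = ereal \<kappa> \<and> b = ereal \<kappa> \<and> E = {\<kappa>}" if "\<kappa> \<in> E" for \<kappa>
    proof -
      have ends: "a = ereal \<kappa>" "b = ereal \<kappa>" using upper[OF that] False by auto
      moreover have "\<kappa>' = \<kappa>" if "\<kappa>' \<in> E" for \<kappa>' using upper[OF that] ends by simp
      ultimately show ?thesis using that by blast
    qed
    show ?thesis
    proof
      assume ?L
      then obtain \<kappa> where "\<kappa> \<in> E" "psi M \<xi> \<kappa> = 0"
        using assms(7) by (auto simp: esscher_parameter_def)
      with sing[OF this(1)] show ?R by auto
    next
      assume ?R
      with False have end_cond: "- \<infinity> < a" "a \<le> b" "b < \<infinity>" "E = ereal -` {a..b}"
        "psi M \<xi> (real_of_ereal a) \<le> 0" "0 \<le> psi M \<xi> (real_of_ereal b)" by auto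
      then obtain r where r: "a = ereal r" "b = ereal r"
        using False by (cases a; cases b) auto
      then have "r \<in> E" "psi M \<xi> r = 0" using end_cond by auto
      then show ?L using fin meas assms(7) by (auto simp: esscher_parameter_iff)
    qed
  qed
qed

end
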